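(* Statements (C) and (D) below are equivalent. (C) For every integer $n\ge 2$ and every transitive permutation $f\in S_n$ (i.e. $f$ is an $n$-cycle), the characteristic sequence $m_1'\le m_2'\le\cdots\le m_{n-1}'$ of $f$ satisfies $m_i'\le i$ for all $i=1,2,\ldots,n-1$. (D) For all integers $n\ge 1$ and $k\ge 1$, for every map $f$ from $\{1,2,\ldots,n\}$ to the set of subsets of $\{1,2,\ldots,n\}$ such that $\bigcup_{i=1}^n f(i)=\{1,2,\ldots,n\}$, and for every partition of $\{1,\ldots,n\}$ into $k$ nonempty blocks of consecutive integers $$I_1=\{1,2,\ldots,i_1\},\quad I_2=\{i_1+1,\ldots,i_2\},\quad\ldots,\quad I_k=\{i_{k-1}+1,\ldots,n\},$$ there exist $j\in\{1,\ldots,k\}$, elements $r,s\in I_j$ (possibly equal), and an integer $l$ with $1\le l\le k$ such that $(\mathrm{conv}f)^l(\{r,s\})\supseteq\{r,s\}$.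
   Context: For a map $f$ from $\{1,\ldots,n\}$ to subsets of $\{1,\ldots,n\}$ and $A\subseteq\{1,\ldots,n\}$, write $f(A)=\bigcup_{a\in A}f(a)$ and let $\mathrm{conv}f(A)=\{\min f(A),\min f(A)+1,\ldots,\max f(A)\}$ be the convex hull of $f(A)$ in the integers (with $\mathrm{conv}f(A)=\emptyset$ if $f(A)=\emptyset$). For a permutation $f\in S_n$ the same notation is used with $f(A)$ the usual image. $(\mathrm{conv}f)^l$ is the $l$-fold iterate of the set map $A\mapsto\mathrm{conv}f(A)$. A permutation $f\in S_n$ is called transitive if it is a single $n$-cycle $(i_1i_2\ldots i_n)$. For such $f$ and $i=1,\ldots,n-1$, let $A_i=\{i,i+1\}$; the characteristic number of $A_i$ is $m_i=\min\{m\ge 1 : (\mathrm{conv}f)^m(A_i)\supseteq A_i\}$. The characteristic sequence of $f$ is the nondecreasing rearrangement $m_1'\le m_2'\le\cdots\le m_{n-1}'$ of $m_1,\ldots,m_{n-1}$. Both (C) and (D) are conjectures; the result is only their equivalence. *)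

theory Defs
  imports "HOL-Combinatorics.Combinatorics"
begin

(* Only meant for finite B; Min and Max are unspecified on infinite sets. *)
definition conv_hull :: "nat set \<Rightarrow> nat set" where
  "conv_hull B = (if B = {} then {} else {Min B..Max B})"

definition conv_setmap :: "(nat \<Rightarrow> nat set) \<Rightarrow> nat set \<Rightarrow> nat set" where
  "conv_setmap f A = conv_hull (\<Union>a\<in>A. f a)"

definition conv_map :: "(nat \<Rightarrow> nat) \<Rightarrow> nat set \<Rightarrow> nat set" where
  "conv_map f A = conv_hull (f ` A)"

(* f is the single n-cycle (i_1 i_2 ... i_n) on {1..n}; cycle_of_list extends it by the
   identity outside {1..n}. *)
definition transitive_perm :: "nat \<Rightarrow> (nat \<Rightarrow> nat) \<Rightarrow> bool" where
  "transitive_perm n f \<longleftrightarrow> f permutes {1..n} \<and>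
     (\<exists>cs. distinct cs \<and> set cs = {1..n} \<and> f = cycle_of_list cs)"

(* The minimum exists for every transitive f in S_n and 1 <= i < n, since m = n qualifies. *)
definition char_number :: "(nat \<Rightarrow> nat) \<Rightarrow> nat \<Rightarrow> nat" where
  "char_number f i = (LEAST m. 1 \<le> m \<and> {i, i + 1} \<subseteq> (conv_map f ^^ m) {i, i + 1})"

(* Lists are indexed from 0, so the term m'_i of the characteristic sequence is
   char_sequence n f ! (i - 1). *)
definition char_sequence :: "nat \<Rightarrow> (nat \<Rightarrow> nat) \<Rightarrow> nat list" where
  "char_sequence n f = sort (map (char_number f) [1..<n])"

(* b j = i_j is the right end point of the j-th block, with the convention i_0 = 0;
   values of b beyond k are irrelevant. *)
definition block_ends :: "nat \<Rightarrow> nat \<Rightarrow> (nat \<Rightarrow> nat) \<Rightarrow> bool" where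
  "block_ends n k b \<longleftrightarrow> b 0 = 0 \<and> b k = n \<and> strict_mono_on {0..k} b"

definition block :: "(nat \<Rightarrow> nat) \<Rightarrow> nat \<Rightarrow> nat set" where
  "block b j = {b (j - 1) + 1..b j}"

end

theory Submission
  imports Defs Complex_Main
begin

text \<open>
  Both conditions are about recurrence of intervals, and each implication is a direct reduction.

  \<^emph>\<open>From block recurrence to characteristic numbers.\<close>  That the \<open>k\<close>-th term of the characteristic
  sequence is at most \<open>k\<close> means that at least \<open>k\<close> of the pairs \<open>{i, i + 1}\<close> have characteristic
  number at most \<open>k\<close> (lemma \<open>char_sequence_le_iff\<close>).  If there are fewer, cut \<open>{1..n}\<close> behind every
  such \<open>i\<close>; this gives at most \<open>k\<close> blocks, so some pair \<open>r, s\<close> in one block returns over itself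
  within \<open>l \<le> k\<close> steps.  An \<open>n\<close>-cycle has no point of period \<open>l < n\<close>, so the pair is a proper
  interval.  The piecewise linear map interpolating the permutation then has, by the intermediate
  value theorem, a non-integral point \<open>x\<close> in \<open>[r, s]\<close> fixed by its \<open>l\<close>-th iterate, and following the
  unit intervals visited by the orbit of \<open>x\<close> shows that the one containing \<open>x\<close> returns
  over itself after \<open>l\<close> steps (lemma \<open>unit_interval_returns\<close>).  This is a pair \<open>{i, i + 1}\<close>
  behind whose first element there is a cut, although \<open>r\<close> and \<open>s\<close> lie in the same block.

  \<^emph>\<open>From characteristic numbers to block recurrence.\<close>  A set-valued map that covers \<open>{1..n}\<close> contains
  a cycle: choose a preimage of every point and follow preimages (lemma \<open>covering_map_has_cycle\<close>).
  Renumbering the points of this cycle in increasing order yields a transitive permutation of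
  \<open>{1..N}\<close> whose convex images are contained in those of the given map.  If \<open>N \<le> k\<close>, a single point of
  the cycle returns in time.  Otherwise at least \<open>k\<close> pairs of neighbours on the cycle return within
  \<open>k\<close> steps, and as only \<open>k - 1\<close> pairs of neighbours can be separated by the \<open>k\<close> blocks, one of
  them lies in a single block.
\<close>

section \<open>Convex images\<close>

lemma in_conv_hull_iff:
  assumes "finite B"
  shows "y \<in> conv_hull B \<longleftrightarrow> (\<exists>u\<in>B. \<exists>v\<in>B. u \<le> y \<and> y \<le> v)"
proof (cases "B = {}")
  case False
  then show ?thesis
    unfolding conv_hull_def using assms
    by (auto intro: Min_in Max_in order_trans[OF Min_le] order_trans[OF _ Max_ge])
qed (simp add: conv_hull_def)

lemma conv_hull_subset_interval:
  assumes "B \<subseteq> {a..b}"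
  shows "conv_hull B \<subseteq> {a..b}"
proof
  fix y assume "y \<in> conv_hull B"
  then obtain u v where "u \<in> B" "v \<in> B" "u \<le> y" "y \<le> v"
    using in_conv_hull_iff[OF finite_subset[OF assms finite_atLeastAtMost]] by blast
  moreover from this have "u \<in> {a..b}" "v \<in> {a..b}" using assms by blast+
  ultimately show "y \<in> {a..b}" by simp
qed

lemma finite_conv_hull: "finite (conv_hull B)"
  by (simp add: conv_hull_def)

lemma in_conv_map_iff:
  assumes "finite A"
  shows "y \<in> conv_map f A \<longleftrightarrow> (\<exists>u\<in>A. \<exists>v\<in>A. f u \<le> y \<and> y \<le> f v)"
  using assms by (simp add: conv_map_def in_conv_hull_iff)

lemma finite_conv_map_funpow: "finite A \<Longrightarrow> finite ((conv_map f ^^ l) A)"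
  by (cases l) (auto simp: conv_map_def finite_conv_hull)

lemma conv_map_funpow_subset:
  assumes f: "f ` {a..b} \<subseteq> {a..b}" and A: "A \<subseteq> {a..b}"
  shows "(conv_map f ^^ l) A \<subseteq> {a..b}"
proof (induction l)
  case (Suc l)
  show ?case
  proof
    fix y assume "y \<in> (conv_map f ^^ Suc l) A"
    then obtain u v where "u \<in> (conv_map f ^^ l) A" "v \<in> (conv_map f ^^ l) A" "f u \<le> y" "y \<le> f v"
      using in_conv_map_iff[OF finite_conv_map_funpow[OF finite_subset[OF A]]] by auto
    moreover from this have "f u \<in> {a..b}" "f v \<in> {a..b}"
      using Suc f by blast+
    ultimately show "y \<in> {a..b}" by simp
  qed
qed (use A in simp)

lemma funpow_in_conv_map_funpow:
  assumes "finite A" "x \<in> A"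
  shows "(f ^^ l) x \<in> (conv_map f ^^ l) A"
proof (induction l)
  case (Suc l)
  then show ?case
    using in_conv_map_iff[OF finite_conv_map_funpow[OF assms(1)]] by auto
qed (use assms in simp)

text \<open>
  A point map is compared with a set-valued map along a monotone relabelling \<open>e\<close>: if \<open>e\<close> carries
  \<open>g\<close> into a selection of \<open>f\<close>, then the intervals generated by \<open>g\<close> are carried into those
  generated by \<open>f\<close>, because points between two values of \<open>g\<close> are sent between their \<open>e\<close>-images.
\<close>

lemma conv_map_funpow_relabel:
  assumes mono: "mono_on {a..b} e" and e: "e ` {a..b} \<subseteq> {c..d}"
    and g: "g ` {a..b} \<subseteq> {a..b}"
    and f: "\<And>x. x \<in> {c..d} \<Longrightarrow> f x \<subseteq> {c..d}"
    and sel: "\<And>i. i \<in> {a..b} \<Longrightarrow> e (g i) \<in> f (e i)"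
    and A: "A \<subseteq> {a..b}"
  shows "e ` (conv_map g ^^ l) A \<subseteq> (conv_setmap f ^^ l) (e ` A) \<and> (conv_setmap f ^^ l) (e ` A) \<subseteq> {c..d}"
proof (induction l)
  case 0
  then show ?case using e A by auto
next
  case (Suc l)
  let ?G = "(conv_map g ^^ l) A" and ?F = "(conv_setmap f ^^ l) (e ` A)"
  have G: "?G \<subseteq> {a..b}"
    by (rule conv_map_funpow_subset[OF g A])
  have finA: "finite A" using A finite_subset by blast
  have UF: "(\<Union>x\<in>?F. f x) \<subseteq> {c..d}"
    using Suc f by blast
  then have finU: "finite (\<Union>x\<in>?F. f x)"
    using finite_subset by blast
  have "e y \<in> (conv_setmap f ^^ Suc l) (e ` A)" if "y \<in> (conv_map g ^^ Suc l) A" for y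
  proof -
    obtain u v where uv: "u \<in> ?G" "v \<in> ?G" "g u \<le> y" "y \<le> g v"
      using \<open>y \<in> _\<close> in_conv_map_iff[OF finite_conv_map_funpow[OF finA]] by auto
    have ab: "u \<in> {a..b}" "v \<in> {a..b}" "g u \<in> {a..b}" "g v \<in> {a..b}"
      using uv G g by blast+
    then have "y \<in> {a..b}" using uv by auto
    then have "e (g u) \<le> e y" "e y \<le> e (g v)"
      using ab uv mono by (auto intro: mono_onD)
    moreover have "e (g u) \<in> (\<Union>x\<in>?F. f x)" "e (g v) \<in> (\<Union>x\<in>?F. f x)"
      using sel ab uv Suc by blast+
    ultimately show ?thesis
      using in_conv_hull_iff[OF finU] by (auto simp: conv_setmap_def)
  qed
  moreover have "(conv_setmap f ^^ Suc l) (e ` A) \<subseteq> {c..d}"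
    using conv_hull_subset_interval[OF UF] by (simp add: conv_setmap_def)
  ultimately show ?case by blast
qed

section \<open>The piecewise linear interpolation\<close>

text \<open>
  The piecewise linear interpolation of the values of \<open>f\<close> at \<open>0, \<dots>, n\<close>, written as a sum of ramps:
  the summand with index \<open>i\<close> runs linearly from \<open>0\<close> at \<open>i\<close> to \<open>f (i + 1) - f i\<close> at \<open>i + 1\<close> and is
  constant on either side.  In this form continuity is immediate.
\<close>

definition interpolate :: "nat \<Rightarrow> (nat \<Rightarrow> nat) \<Rightarrow> real \<Rightarrow> real" where
  "interpolate n f x =
     real (f 0) + (\<Sum>i<n. (real (f (Suc i)) - real (f i)) * max 0 (min 1 (x - real i)))"

lemma continuous_on_interpolate: "continuous_on S (interpolate n f)"
  unfolding interpolate_def by (intro continuous_intros)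

lemma continuous_on_interpolate_funpow: "continuous_on S (interpolate n f ^^ l)"
proof (induction l)
  case 0
  then show ?case by (simp add: id_def)
next
  case (Suc l)
  then show ?case
    using continuous_on_compose[OF _ continuous_on_interpolate] by simp
qed

lemma interpolate_split:
  assumes "0 \<le> t" "t \<le> 1"
  shows "interpolate n f (real j + t) =
     (if j < n then (1 - t) * real (f j) + t * real (f (Suc j)) else real (f n))"
proof (induction n)
  case 0
  then show ?case by (simp add: interpolate_def)
next
  case (Suc n)
  have step: "interpolate (Suc n) f (real j + t) = interpolate n f (real j + t) +
     (real (f (Suc n)) - real (f n)) * max 0 (min 1 (real j + t - real n))"
    by (simp add: interpolate_def)
  consider "n < j" | "n = j" | "j < n" by linarith
  then show ?case
  proof cases
    case 1
    then have "max 0 (min 1 (real j + t - real n)) = 1" using assms by simp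
    then show ?thesis using step Suc 1 by simp
  next
    case 2
    then show ?thesis using step Suc assms by (simp add: algebra_simps)
  next
    case 3
    then have "real j + 1 \<le> real n" by simp
    then have "max 0 (min 1 (real j + t - real n)) = 0" using assms by simp
    then show ?thesis using step Suc 3 by simp
  qed
qed

lemma interpolate_of_nat: "j \<le> n \<Longrightarrow> interpolate n f (real j) = real (f j)"
  using interpolate_split[of 0 n f j] by (auto split: if_splits)

lemma interpolate_funpow_of_nat:
  assumes "f ` {..n} \<subseteq> {..n}" "j \<le> n"
  shows "(interpolate n f ^^ l) (real j) = real ((f ^^ l) j) \<and> (f ^^ l) j \<le> n"
proof (induction l)
  case (Suc l)
  then show ?case
    using assms(1) interpolate_of_nat by auto
qed (use assms in simp)

lemma interpolate_between:
  assumes "real j \<le> x" "x \<le> real j + 1" "j < n"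
  shows "real (min (f j) (f (j + 1))) \<le> interpolate n f x"
    "interpolate n f x \<le> real (max (f j) (f (j + 1)))"
proof -
  define t where "t = x - real j"
  have t: "0 \<le> t" "t \<le> 1" "x = real j + t" using assms by (auto simp: t_def)
  have eq: "interpolate n f x = (1 - t) * real (f j) + t * real (f (j + 1))"
    using interpolate_split[OF t(1,2), of n f j] assms(3) t(3) by simp
  show "interpolate n f x \<le> real (max (f j) (f (j + 1)))"
    unfolding eq using t by (intro convex_bound_le) auto
  have "(1 - t) * (- real (f j)) + t * (- real (f (j + 1))) \<le> - real (min (f j) (f (j + 1)))"
    using t by (intro convex_bound_le) auto
  then show "real (min (f j) (f (j + 1))) \<le> interpolate n f x"
    unfolding eq by simp
qed

text \<open>
  The image of an interval under a continuous map is an interval, so it contains the integers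
  between any two of its integral values; these are what convex images add.
\<close>

lemma conv_map_funpow_subset_interpolate:
  assumes f: "f ` {..n} \<subseteq> {..n}" and rs: "r \<le> s" "s \<le> n"
    and y: "y \<in> (conv_map f ^^ l) {r, s}"
  shows "\<exists>x\<in>{real r..real s}. (interpolate n f ^^ l) x = real y"
  using y
proof (induction l arbitrary: y)
  case 0
  then show ?case using rs by auto
next
  case (Suc l)
  let ?h = "interpolate n f ^^ Suc l"
  obtain u v where uv: "u \<in> (conv_map f ^^ l) {r, s}" "v \<in> (conv_map f ^^ l) {r, s}"
      "f u \<le> y" "y \<le> f v"
    using Suc.prems in_conv_map_iff[OF finite_conv_map_funpow[of "{r, s}"]] by auto
  have le: "u \<le> n" "v \<le> n"
    using conv_map_funpow_subset[of f 0 n "{r, s}" l] f rs uv by (auto simp: atMost_atLeast0)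
  have "real (f w) \<in> ?h ` {real r..real s}" if "w \<in> (conv_map f ^^ l) {r, s}" "w \<le> n" for w
  proof -
    obtain x where "x \<in> {real r..real s}" "(interpolate n f ^^ l) x = real w"
      using Suc.IH[OF \<open>w \<in> _\<close>] by blast
    then show ?thesis
      using interpolate_of_nat[OF \<open>w \<le> n\<close>, of f] by (intro image_eqI[of _ _ x]) simp_all
  qed
  then have "real (f u) \<in> ?h ` {real r..real s}" "real (f v) \<in> ?h ` {real r..real s}"
    using uv le by blast+
  moreover have "connected (?h ` {real r..real s})"
    by (intro connected_continuous_image continuous_on_interpolate_funpow connected_Icc)
  ultimately have "real y \<in> ?h ` {real r..real s}"
    using connectedD_interval[of "?h ` {real r..real s}" "real (f u)" "real (f v)" "real y"] uv(3,4)
    by (simp del: funpow.simps)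
  then show ?case by (metis imageE)
qed

text \<open>
  The \<open>l\<close>-th iterate takes the values \<open>r\<close> and \<open>s\<close> on \<open>[r, s]\<close>, so its displacement is nonpositive
  at one point of this interval and nonnegative at another.
\<close>

lemma interpolate_funpow_fixed_point:
  assumes f: "f ` {..n} \<subseteq> {..n}" and rs: "r \<le> s" "s \<le> n"
    and ret: "{r, s} \<subseteq> (conv_map f ^^ l) {r, s}"
  obtains x where "x \<in> {real r..real s}" "(interpolate n f ^^ l) x = x"
proof -
  let ?d = "\<lambda>x. (interpolate n f ^^ l) x - x"
  obtain x y where x: "x \<in> {real r..real s}" "(interpolate n f ^^ l) x = real r"
    and y: "y \<in> {real r..real s}" "(interpolate n f ^^ l) y = real s"
    using conv_map_funpow_subset_interpolate[OF f rs] ret by (meson insert_subset)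
  have "connected (?d ` {real r..real s})"
    by (intro connected_continuous_image continuous_intros continuous_on_interpolate_funpow
        connected_Icc)
  moreover have "?d x \<le> 0" "0 \<le> ?d y" using x y by auto
  ultimately have "0 \<in> ?d ` {real r..real s}"
    using connectedD_interval[of "?d ` {real r..real s}" "?d x" "?d y" 0] imageI[OF x(1), of ?d]
      imageI[OF y(1), of ?d] by simp
  then obtain z where "z \<in> {real r..real s}" "0 = ?d z" by blast
  then show thesis using that[of z] by simp
qed

text \<open>
  If no integer of \<open>[r, s]\<close> has period \<open>l\<close>, the fixed point of the \<open>l\<close>-th iterate provided by the
  intermediate value theorem has an orbit free of integers: from an integer the orbit would continue
  through integers and make the fixed point itself an integer of period \<open>l\<close>.
  Each step of the orbit then leads from one unit interval to a unit interval covered by its image.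
\<close>

lemma unit_interval_returns:
  assumes f: "f ` {..n} \<subseteq> {..n}" and rs: "r \<le> s" "s \<le> n"
    and ret: "{r, s} \<subseteq> (conv_map f ^^ l) {r, s}"
    and aperiodic: "\<And>i. i \<in> {r..s} \<Longrightarrow> (f ^^ l) i \<noteq> i"
  shows "\<exists>i\<in>{r..<s}. {i, i + 1} \<subseteq> (conv_map f ^^ l) {i, i + 1}"
proof -
  let ?g = "interpolate n f"
  obtain x where x: "x \<in> {real r..real s}" "(?g ^^ l) x = x"
    using interpolate_funpow_fixed_point[OF f rs ret] by blast
  have x_nonint: "x \<noteq> real j" for j
    using x aperiodic[of j] interpolate_funpow_of_nat[OF f, of j l] rs by auto
  have orbit_nonint: "(?g ^^ t) x \<noteq> real j" if "t \<le> l" "j \<le> n" for t j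
  proof
    assume "(?g ^^ t) x = real j"
    moreover have "(?g ^^ l) x = (?g ^^ (l - t)) ((?g ^^ t) x)"
      using that(1) by (metis comp_apply funpow_add le_add_diff_inverse2)
    ultimately show False
      using interpolate_funpow_of_nat[OF f that(2)] x x_nonint by metis
  qed
  define i where "i = nat \<lfloor>x\<rfloor>"
  have i: "real i < x" "x < real i + 1"
    using x x_nonint[of i] by (auto simp: i_def) linarith+
  have irs: "i \<in> {r..<s}"
    using i x x_nonint[of s] by auto
  \<comment> \<open>The unit interval visited at time \<open>t\<close> lies in the \<open>t\<close>-th convex image of the one around \<open>x\<close>.\<close>
  have "t \<le> l \<Longrightarrow> \<exists>m<n. real m < (?g ^^ t) x \<and> (?g ^^ t) x < real m + 1 \<and>
      {m, m + 1} \<subseteq> (conv_map f ^^ t) {i, i + 1}" for t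
  proof (induction t)
    case 0
    then show ?case using i irs rs by (intro exI[of _ i]) auto
  next
    case (Suc t)
    then obtain j where j: "j < n" "real j < (?g ^^ t) x" "(?g ^^ t) x < real j + 1"
        "{j, j + 1} \<subseteq> (conv_map f ^^ t) {i, i + 1}"
      by auto
    let ?y = "(?g ^^ Suc t) x"
    have y: "real (min (f j) (f (j + 1))) \<le> ?y" "?y \<le> real (max (f j) (f (j + 1)))"
      using interpolate_between[of j "(?g ^^ t) x" n f] j by simp_all
    have fn: "max (f j) (f (j + 1)) \<le> n" using f j(1) by (simp add: image_subset_iff)
    define m where "m = nat \<lfloor>?y\<rfloor>"
    have "0 \<le> ?y" using y(1) by linarith
    moreover have "m \<le> n" using y(2) fn unfolding m_def by linarith
    ultimately have m: "real m < ?y" "?y < real m + 1"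
      using orbit_nonint[OF Suc.prems \<open>m \<le> n\<close>] unfolding m_def by linarith+
    have fm: "min (f j) (f (j + 1)) \<le> m" "m + 1 \<le> max (f j) (f (j + 1))"
      using y m by linarith+
    have "z \<in> conv_map f ((conv_map f ^^ t) {i, i + 1})" if "z \<in> {m, m + 1}" for z
    proof -
      have "min (f j) (f (j + 1)) \<le> z" "z \<le> max (f j) (f (j + 1))"
        using fm that by auto
      then show ?thesis
        using j(4) in_conv_map_iff[OF finite_conv_map_funpow[of "{i, i + 1}"]]
        by (auto simp: min_def max_def split: if_splits)
    qed
    then have "{m, m + 1} \<subseteq> (conv_map f ^^ Suc t) {i, i + 1}"
      by auto
    moreover have "m < n" using fm fn by linarith
    ultimately show ?case using m by (intro exI[of _ m] conjI)
  qed
  from this[of l] obtain m where m: "real m < x" "x < real m + 1"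
      "{m, m + 1} \<subseteq> (conv_map f ^^ l) {i, i + 1}"
    using x(2) by auto
  have "m = i" using m i by linarith
  then show ?thesis using m irs by blast
qed

section \<open>Transitive permutations and characteristic numbers\<close>

lemma cycle_of_list_funpow_nth:
  assumes "distinct cs" "i < length cs"
  shows "(cycle_of_list cs ^^ l) (cs ! i) = cs ! ((i + l) mod length cs)"
proof -
  have "map (cycle_of_list cs ^^ l) cs ! i = rotate l cs ! i"
    using cyclic_rotation[OF assms(1)] by simp
  then show ?thesis
    using assms(2) by (simp add: nth_rotate add.commute)
qed

lemma transitive_perm_list:
  assumes "transitive_perm n f"
  obtains cs where "distinct cs" "set cs = {1..n}" "length cs = n" "f = cycle_of_list cs"
  using assms unfolding transitive_perm_def by (metis card_atLeastAtMost diff_Suc_1 distinct_card)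

lemma transitive_perm_funpow_n:
  assumes "transitive_perm n f" "x \<in> {1..n}"
  shows "(f ^^ n) x = x"
proof -
  obtain cs where cs: "distinct cs" "set cs = {1..n}" "length cs = n" "f = cycle_of_list cs"
    using transitive_perm_list[OF assms(1)] .
  obtain i where "i < n" "x = cs ! i"
    using assms(2) cs by (metis in_set_conv_nth)
  then show ?thesis using cycle_of_list_funpow_nth[OF cs(1), of i n] cs by simp
qed

lemma transitive_perm_aperiodic:
  assumes "transitive_perm n f" "x \<in> {1..n}" "1 \<le> l" "l < n"
  shows "(f ^^ l) x \<noteq> x"
proof
  assume fx: "(f ^^ l) x = x"
  obtain cs where cs: "distinct cs" "set cs = {1..n}" "length cs = n" "f = cycle_of_list cs"
    using transitive_perm_list[OF assms(1)] .
  obtain i where i: "i < n" "x = cs ! i"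
    using assms(2) cs by (metis in_set_conv_nth)
  then have "cs ! ((i + l) mod n) = cs ! i"
    using cycle_of_list_funpow_nth[OF cs(1), of i l] cs fx by simp
  then have "(i + l) mod n = i"
    using cs i by (simp add: nth_eq_iff_index_eq)
  then show False
    using assms(3,4) i by (cases "i + l < n") (auto simp: mod_if[of "i + l"])
qed

lemma char_number_returns:
  assumes "transitive_perm n f" "i \<in> {1..<n}"
  shows "1 \<le> char_number f i" "{i, i + 1} \<subseteq> (conv_map f ^^ char_number f i) {i, i + 1}"
proof -
  have "x \<in> (conv_map f ^^ n) {i, i + 1}" if "x \<in> {i, i + 1}" for x
    using funpow_in_conv_map_funpow[OF _ that, of n f] transitive_perm_funpow_n[OF assms(1), of x]
      that assms(2) by auto
  then have "1 \<le> n \<and> {i, i + 1} \<subseteq> (conv_map f ^^ n) {i, i + 1}"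
    using assms(2) by auto
  then have "1 \<le> char_number f i \<and> {i, i + 1} \<subseteq> (conv_map f ^^ char_number f i) {i, i + 1}"
    unfolding char_number_def by (rule LeastI)
  then show "1 \<le> char_number f i" "{i, i + 1} \<subseteq> (conv_map f ^^ char_number f i) {i, i + 1}"
    by auto
qed

lemma char_number_le:
  "1 \<le> l \<Longrightarrow> {i, i + 1} \<subseteq> (conv_map f ^^ l) {i, i + 1} \<Longrightarrow> char_number f i \<le> l"
  unfolding char_number_def by (rule Least_le) simp

text \<open>In a sorted list the entries bounded by \<open>m\<close> form a prefix, whose length is their number.\<close>

lemma sort_nth_le_iff:
  fixes m :: "'a :: linorder"
  assumes "i < length xs"
  shows "sort xs ! i \<le> m \<longleftrightarrow> i < length (filter (\<lambda>x. x \<le> m) xs)"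
proof -
  let ?I = "{j. j < length xs \<and> sort xs ! j \<le> m}"
  have len: "length (filter (\<lambda>x. x \<le> m) xs) = card ?I"
    using length_filter_conv_card[of "\<lambda>x. x \<le> m" "sort xs"]
    by (simp add: filter_sort)
  show ?thesis
  proof
    assume le: "sort xs ! i \<le> m"
    have "{..i} \<subseteq> ?I"
    proof
      fix j assume "j \<in> {..i}"
      then have "sort xs ! j \<le> sort xs ! i"
        using assms by (intro sorted_nth_mono) auto
      then show "j \<in> ?I" using le assms \<open>j \<in> {..i}\<close> by auto
    qed
    then have "card {..i} \<le> card ?I" by (intro card_mono) auto
    then show "i < length (filter (\<lambda>x. x \<le> m) xs)" using len by simp
  next
    assume less: "i < length (filter (\<lambda>x. x \<le> m) xs)"
    show "sort xs ! i \<le> m"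
    proof (rule ccontr)
      assume gt: "\<not> sort xs ! i \<le> m"
      have "?I \<subseteq> {..<i}"
      proof
        fix j assume j: "j \<in> ?I"
        have "sort xs ! i \<le> sort xs ! j" if "i \<le> j"
          using that j by (intro sorted_nth_mono) auto
        then show "j \<in> {..<i}" using j gt by force
      qed
      then have "card ?I \<le> card {..<i}" by (intro card_mono) auto
      then show False using len less by simp
    qed
  qed
qed

lemma char_sequence_le_iff:
  assumes "k \<in> {1..n - 1}"
  shows "char_sequence n f ! (k - 1) \<le> m \<longleftrightarrow> k \<le> card {i \<in> {1..<n}. char_number f i \<le> m}"
proof -
  let ?ms = "map (char_number f) [1..<n]"
  have "length (filter (\<lambda>x. x \<le> m) ?ms) = length (filter (\<lambda>i. char_number f i \<le> m) [1..<n])"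
    by (simp add: filter_map comp_def)
  also have "\<dots> = card {i \<in> {1..<n}. char_number f i \<le> m}"
    by (simp add: distinct_length_filter Int_def conj_commute)
  finally have len: "length (filter (\<lambda>x. x \<le> m) ?ms) = card {i \<in> {1..<n}. char_number f i \<le> m}" .
  have "k - 1 < length ?ms" using assms by auto
  then have "char_sequence n f ! (k - 1) \<le> m \<longleftrightarrow> k - 1 < length (filter (\<lambda>x. x \<le> m) ?ms)"
    unfolding char_sequence_def by (rule sort_nth_le_iff)
  then show ?thesis
    unfolding len using assms by auto
qed

section \<open>Blocks\<close>

text \<open>Cutting behind every element of \<open>J\<close>: the block ends are \<open>0\<close>, the elements of \<open>J\<close>, and \<open>n\<close>.\<close>

lemma block_ends_of_cuts:
  assumes "n \<ge> 1" "J \<subseteq> {1..<n}"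
  obtains b where "block_ends n (card J + 1) b"
    "\<And>j r s i. j \<in> {1..card J + 1} \<Longrightarrow> r \<in> block b j \<Longrightarrow> s \<in> block b j \<Longrightarrow> i \<in> {r..<s} \<Longrightarrow> i \<notin> J"
proof -
  define E where "E = insert 0 (insert n J)"
  define L where "L = sorted_list_of_set E"
  have finJ: "finite J" using assms(2) finite_subset by blast
  then have finE: "finite E" by (simp add: E_def)
  have notin: "0 \<notin> insert n J" "n \<notin> J" using assms by auto
  have setL: "set L = E" using finE by (simp add: L_def)
  have "card E = card J + 2"
    using notin finJ by (simp add: E_def)
  then have len: "length L = card J + 2" by (simp add: L_def)
  have less: "L ! p < L ! q" if "p < q" "q \<le> card J + 1" for p q
    using strict_sorted_list_of_set[of E] that len unfolding L_def
    by (metis One_nat_def add_2_eq_Suc' le_imp_less_Suc add.right_neutral add_Suc_right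
        sorted_wrt_nth_less)
  have le: "L ! p \<le> L ! q" if "p \<le> q" "q \<le> card J + 1" for p q
    using less[of p q] that by (cases "p = q") auto
  have ex: "\<exists>p. p \<le> card J + 1 \<and> L ! p = x" if "x \<in> E" for x
  proof -
    obtain p where "p < length L" "L ! p = x" using \<open>x \<in> E\<close> setL by (metis in_set_conv_nth)
    then show ?thesis using len by (intro exI[of _ p]) simp
  qed
  obtain p0 pn where "p0 \<le> card J + 1" "L ! p0 = 0" and pn: "pn \<le> card J + 1" "L ! pn = n"
    using ex[of 0] ex[of n] by (auto simp: E_def)
  then have "L ! 0 = 0"
    using le[of 0 p0] by simp
  moreover have "L ! (card J + 1) = n"
  proof (rule antisym)
    have "L ! (card J + 1) \<in> E" using len setL by (metis add_2_eq_Suc' lessI Suc_eq_plus1 nth_mem)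
    then show "L ! (card J + 1) \<le> n" using assms by (auto simp: E_def)
    show "n \<le> L ! (card J + 1)"
      using le[OF pn(1)] pn(2) by simp
  qed
  ultimately have be: "block_ends n (card J + 1) ((!) L)"
    using less by (auto simp: block_ends_def intro!: strict_mono_onI)
  have "i \<notin> J" if j: "j \<in> {1..card J + 1}" and r: "r \<in> block ((!) L) j"
    and s: "s \<in> block ((!) L) j" and i: "i \<in> {r..<s}" for j r s i
  proof
    assume "i \<in> J"
    then obtain p where p: "p \<le> card J + 1" "L ! p = i"
      using ex[of i] by (auto simp: E_def)
    have "L ! (j - 1) < i" "i < L ! j"
      using r s i by (auto simp: block_def)
    then have "\<not> (p \<le> j - 1 \<and> j - 1 \<le> card J + 1)" "\<not> j \<le> p"
      using le[of p "j - 1"] le[of j p] p by auto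
    then show False using j by auto
  qed
  then show thesis using that be by blast
qed

definition block_index :: "(nat \<Rightarrow> nat) \<Rightarrow> nat \<Rightarrow> nat" where
  "block_index b x = (LEAST j. x \<le> b j)"

lemma block_index:
  assumes be: "block_ends n k b" and x: "x \<in> {1..n}"
  shows "block_index b x \<in> {1..k}" "x \<in> block b (block_index b x)"
proof -
  have xk: "x \<le> b k" using x be by (simp add: block_ends_def)
  have xB: "x \<le> b (block_index b x)" unfolding block_index_def using xk by (rule LeastI)
  have "block_index b x \<le> k" unfolding block_index_def using xk by (rule Least_le)
  moreover have nz: "block_index b x \<noteq> 0"
  proof
    assume "block_index b x = 0"
    then show False using xB x be by (simp add: block_ends_def)
  qed
  moreover have "b (block_index b x - 1) < x"
    using not_less_Least[of "block_index b x - 1" "\<lambda>j. x \<le> b j"] nz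
    unfolding block_index_def by simp
  ultimately show "block_index b x \<in> {1..k}" "x \<in> block b (block_index b x)"
    using xB by (auto simp: block_def)
qed

lemma block_index_mono:
  assumes "block_ends n k b" "x \<le> y" "y \<in> {1..n}"
  shows "block_index b x \<le> block_index b y"
proof -
  have "x \<le> b (block_index b y)"
    using block_index(2)[OF assms(1,3)] assms(2) by (simp add: block_def)
  then show ?thesis unfolding block_index_def[of b x] by (rule Least_le)
qed

text \<open>
  Along a nondecreasing family the block index runs through at most \<open>k\<close> values, so it grows in at
  most \<open>k - 1\<close> places, and among \<open>k\<close> pairs of successive members there is one that stays in a block.
\<close>

lemma consecutive_in_block:
  fixes e :: "nat \<Rightarrow> nat"
  assumes be: "block_ends n k b" and e: "mono_on {1..N} e" "e ` {1..N} \<subseteq> {1..n}"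
    and S: "S \<subseteq> {1..<N}" "k \<le> card S" "1 \<le> k"
  shows "\<exists>i\<in>S. \<exists>j\<in>{1..k}. e i \<in> block b j \<and> e (i + 1) \<in> block b j"
proof (rule ccontr)
  assume separated: "\<not> ?thesis"
  let ?B = "block_index b"
  have en: "e i \<in> {1..n}" if "i \<in> {1..N}" for i using e(2) that by blast
  have step: "?B (e i) < ?B (e (i + 1))" if "i \<in> S" for i
  proof -
    have iN: "i \<in> {1..N}" "i + 1 \<in> {1..N}" using subsetD[OF S(1) that] by auto
    then have "?B (e i) \<le> ?B (e (i + 1))"
      using e(1) en by (intro block_index_mono[OF be]) (auto intro: mono_onD)
    moreover have "?B (e i) \<noteq> ?B (e (i + 1))"
      using separated that block_index[OF be en[OF iN(1)]] block_index[OF be en[OF iN(2)]] by metis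
    ultimately show ?thesis by simp
  qed
  have less: "?B (e i) < ?B (e i')" if "i \<in> S" "i' \<in> S" "i < i'" for i i'
  proof -
    have "i + 1 \<in> {1..N}" "i' \<in> {1..N}" using subsetD[OF S(1)] that by force+
    then have "?B (e (i + 1)) \<le> ?B (e i')"
      using that(3) e(1) en by (intro block_index_mono[OF be]) (auto intro: mono_onD)
    then show ?thesis using step[OF that(1)] by simp
  qed
  have "inj_on (\<lambda>i. ?B (e i)) S"
    by (rule linorder_inj_onI) (use less in \<open>force+\<close>)
  moreover have "(\<lambda>i. ?B (e i)) ` S \<subseteq> {1..<k}"
  proof
    fix j assume "j \<in> (\<lambda>i. ?B (e i)) ` S"
    then obtain i where i: "i \<in> S" "j = ?B (e i)" by blast
    then have "i \<in> {1..N}" "i + 1 \<in> {1..N}" using subsetD[OF S(1) i(1)] by auto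
    then show "j \<in> {1..<k}"
      using block_index(1)[OF be en, of i] block_index(1)[OF be en, of "i + 1"] step[OF i(1)] i(2)
      by auto
  qed
  ultimately have "card S \<le> card {1..<k}"
    by (metis card_image card_mono finite_atLeastLessThan)
  then show False using S by simp
qed

section \<open>Cycles in covering set-valued maps\<close>

text \<open>
  Any map \<open>p\<close> choosing preimages on a finite set has a periodic point; its orbit under \<open>p\<close>, read
  backwards and cut at the least period, is a cycle of the set-valued map without repetitions.
\<close>

lemma covering_map_has_cycle:
  assumes "finite D" "D \<noteq> {}" "D \<subseteq> (\<Union>x\<in>D. f x)"
  obtains c where "c \<noteq> []" "distinct c" "set c \<subseteq> D"
    "\<And>i. i < length c \<Longrightarrow> c ! ((i + 1) mod length c) \<in> f (c ! i)"
proof -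
  have "\<exists>p. \<forall>y\<in>D. p y \<in> D \<and> y \<in> f (p y)"
    using assms(3) by (intro bchoice) blast
  then obtain p where p: "\<And>y. y \<in> D \<Longrightarrow> p y \<in> D" "\<And>y. y \<in> D \<Longrightarrow> y \<in> f (p y)" by blast
  obtain y1 where y1: "y1 \<in> D" using assms(2) by blast
  have pD: "(p ^^ i) y \<in> D" if "y \<in> D" for i y
    using that p(1) by (induction i) auto
  have "\<not> inj (\<lambda>i. (p ^^ i) y1)"
    using finite_subset[of "range (\<lambda>i. (p ^^ i) y1)" D] pD[OF y1] assms(1)
    by (metis finite_imageD image_subsetI infinite_UNIV_nat)
  then obtain a a' where a: "a < a'" "(p ^^ a) y1 = (p ^^ a') y1"
    unfolding inj_def by (metis linorder_neqE_nat)
  define y0 where "y0 = (p ^^ a) y1"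
  have y0: "y0 \<in> D" using pD[OF y1] by (simp add: y0_def)
  define N where "N = (LEAST N. 1 \<le> N \<and> (p ^^ N) y0 = y0)"
  have "(p ^^ (a' - a)) y0 = (p ^^ a') y1"
    using a(1) unfolding y0_def by (metis comp_apply funpow_add le_add_diff_inverse2 less_imp_le)
  then have "1 \<le> a' - a \<and> (p ^^ (a' - a)) y0 = y0"
    using a by (simp add: y0_def)
  then have "1 \<le> N \<and> (p ^^ N) y0 = y0"
    unfolding N_def by (rule LeastI)
  then have N: "1 \<le> N" "(p ^^ N) y0 = y0" by auto
  have N_least: "(p ^^ m) y0 \<noteq> y0" if "1 \<le> m" "m < N" for m
    using not_less_Least[of m "\<lambda>N. 1 \<le> N \<and> (p ^^ N) y0 = y0"] that unfolding N_def by blast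
  have inj: "(p ^^ i) y0 \<noteq> (p ^^ j) y0" if "i < j" "j \<le> N" "1 \<le> i" for i j
  proof
    assume eq: "(p ^^ i) y0 = (p ^^ j) y0"
    have "(p ^^ (N - j + i)) y0 = (p ^^ (N - j)) ((p ^^ j) y0)"
      by (simp add: funpow_add eq)
    also have "\<dots> = (p ^^ N) y0"
      using that(2) by (metis comp_apply funpow_add le_add_diff_inverse2)
    finally have "(p ^^ (N - j + i)) y0 = y0" using N(2) by simp
    moreover have "1 \<le> N - j + i" "N - j + i < N" using that by linarith+
    ultimately show False using N_least by blast
  qed
  \<comment> \<open>The exponent \<open>N\<close> at index \<open>0\<close> puts \<open>y0\<close> there, so the last entry \<open>p y0\<close> is followed by \<open>y0\<close>.\<close>
  define c where "c = map (\<lambda>i. (p ^^ (N - i)) y0) [0..<N]"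
  have len: "length c = N" by (simp add: c_def)
  have nth: "c ! i = (p ^^ (N - i)) y0" if "i < N" for i using that by (simp add: c_def)
  have "distinct c"
    unfolding distinct_conv_nth len
  proof (intro allI impI)
    fix i j assume "i < N" "j < N" "i \<noteq> j"
    then show "c ! i \<noteq> c ! j"
      using inj[of "N - i" "N - j"] inj[of "N - j" "N - i"] nth by (cases "i < j") force+
  qed
  moreover have "set c \<subseteq> D" using pD[OF y0] by (auto simp: c_def)
  moreover have "c \<noteq> []" using N(1) len by auto
  moreover have "c ! ((i + 1) mod length c) \<in> f (c ! i)" if "i < length c" for i
  proof -
    have "c ! ((i + 1) mod N) = (p ^^ (N - (i + 1))) y0"
    proof (cases "i + 1 < N")
      case False
      then have "i + 1 = N" using that len by simp
      then show ?thesis using nth[of 0] N by simp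
    qed (simp add: nth)
    moreover have "c ! i = p ((p ^^ (N - (i + 1))) y0)"
      using that len nth[of i] by (metis Suc_diff_Suc Suc_eq_plus1 comp_apply funpow.simps(2))
    ultimately show ?thesis using p(2)[OF pD[OF y0]] len by simp
  qed
  ultimately show thesis using that by blast
qed

text \<open>Renumbering the points of a cycle in increasing order makes it a transitive permutation.\<close>

lemma cycle_relabelling:
  fixes c :: "nat list"
  assumes "c \<noteq> []" "distinct c"
    and step: "\<And>i. i < length c \<Longrightarrow> c ! ((i + 1) mod length c) \<in> f (c ! i)"
  obtains e g where "transitive_perm (length c) g" "mono_on {1..length c} e"
    "e ` {1..length c} = set c" "\<And>i. i \<in> {1..length c} \<Longrightarrow> e (g i) \<in> f (e i)"
proof -
  let ?N = "length c"
  define L where "L = sorted_list_of_set (set c)"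
  have L: "length L = ?N" "set L = set c" "sorted L" "distinct L"
    using assms(2) by (auto simp: L_def distinct_card)
  define e where "e i = L ! (i - 1)" for i
  have mono: "mono_on {1..?N} e"
    unfolding e_def using L by (auto intro!: mono_onI sorted_nth_mono)
  have "bij_betw (\<lambda>i. i - 1) {1..?N} {..<?N}"
    by (rule bij_betw_byWitness[where f' = Suc]) auto
  then have bij: "bij_betw e {1..?N} (set c)"
    using bij_betw_trans[OF _ bij_betw_nth[OF L(4) refl refl]] L
    by (fastforce simp: e_def[abs_def] comp_def)
  define e' where "e' = the_inv_into {1..?N} e"
  have bij': "bij_betw e' (set c) {1..?N}"
    unfolding e'_def by (rule bij_betw_the_inv_into[OF bij])
  have ee': "e (e' x) = x" if "x \<in> set c" for x
    unfolding e'_def using that bij by (auto simp: bij_betw_def intro: f_the_inv_into_f)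
  define cs where "cs = map e' c"
  have cs: "distinct cs" "set cs = {1..?N}" "length cs = ?N"
    using assms(2) bij' by (auto simp: cs_def distinct_map bij_betw_def)
  define g where "g = cycle_of_list cs"
  have "g permutes {1..?N}"
    unfolding g_def using cycle_permutes[of cs] cs by simp
  then have "transitive_perm ?N g"
    using cs g_def unfolding transitive_perm_def by blast
  moreover have "e (g i) \<in> f (e i)" if "i \<in> {1..?N}" for i
  proof -
    obtain q where q: "q < ?N" "i = cs ! q"
      using \<open>i \<in> {1..?N}\<close> cs(2,3) by (metis in_set_conv_nth)
    have q': "(q + 1) mod ?N < ?N" using assms(1) by simp
    have "g i = cs ! ((q + 1) mod ?N)"
      using cycle_of_list_funpow_nth[OF cs(1), of q 1] q cs by (simp add: g_def)
    then have "e (g i) = c ! ((q + 1) mod ?N)" "e i = c ! q"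
      using q q' ee' by (simp_all add: cs_def)
    then show ?thesis using step[OF q(1)] by simp
  qed
  moreover have "e ` {1..?N} = set c" using bij by (simp add: bij_betw_def)
  ultimately show thesis using that mono by blast
qed

section \<open>The two implications\<close>

lemma char_sequence_le_if_block_returns:
  assumes D: "\<And>k (f :: nat \<Rightarrow> nat set) b. 1 \<le> k \<Longrightarrow>
      (\<forall>i\<in>{1..n}. f i \<subseteq> {1..n}) \<Longrightarrow> (\<Union>i\<in>{1..n}. f i) = {1..n} \<Longrightarrow> block_ends n k b \<Longrightarrow>
      \<exists>j\<in>{1..k}. \<exists>r\<in>block b j. \<exists>s\<in>block b j. \<exists>l\<in>{1..k}. {r, s} \<subseteq> (conv_setmap f ^^ l) {r, s}"
    and f: "transitive_perm n f" and k: "k \<in> {1..n - 1}"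
  shows "char_sequence n f ! (k - 1) \<le> k"
proof (rule ccontr)
  define J where "J = {i \<in> {1..<n}. char_number f i \<le> k}"
  assume "\<not> ?thesis"
  then have card: "card J < k"
    using char_sequence_le_iff[OF k] by (simp add: J_def)
  have n: "n \<ge> 1" using k by auto
  have perm: "f permutes {1..n}" using f by (simp add: transitive_perm_def)
  then have img: "f ` {1..n} = {1..n}" by (rule permutes_image)
  have J: "J \<subseteq> {1..<n}" unfolding J_def by blast
  obtain b where b: "block_ends n (card J + 1) b"
    and cut: "\<And>j r s i. j \<in> {1..card J + 1} \<Longrightarrow> r \<in> block b j \<Longrightarrow> s \<in> block b j \<Longrightarrow>
      i \<in> {r..<s} \<Longrightarrow> i \<notin> J"
    by (rule block_ends_of_cuts[OF n J]) (rule that, assumption+)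
  \<comment> \<open>The permutation, read as a set-valued map with singleton values, has the same convex images.\<close>
  let ?F = "\<lambda>i. {f i}"
  have F: "conv_setmap ?F = conv_map f"
    by (auto simp: fun_eq_iff conv_setmap_def conv_map_def UNION_singleton_eq_range)
  have "\<exists>j\<in>{1..card J + 1}. \<exists>r\<in>block b j. \<exists>s\<in>block b j. \<exists>l\<in>{1..card J + 1}.
      {r, s} \<subseteq> (conv_setmap ?F ^^ l) {r, s}"
    using img by (intro D[OF _ _ _ b]) auto
  then obtain j r s l where j: "j \<in> {1..card J + 1}" "r \<in> block b j" "s \<in> block b j"
    and l: "l \<in> {1..card J + 1}" and ret: "{r, s} \<subseteq> (conv_map f ^^ l) {r, s}"
    unfolding F by blast
  define u v where "u = min r s" and "v = max r s"
  have uv: "u \<le> v" "{u, v} = {r, s}" "u \<in> block b j" "v \<in> block b j"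
    using j by (auto simp: u_def v_def min_def max_def)
  have "b j \<le> b (card J + 1)"
  proof (cases "j = card J + 1")
    case False
    then have "b j < b (card J + 1)"
      using b j(1) unfolding block_ends_def by (auto intro: strict_mono_onD)
    then show ?thesis by simp
  qed simp
  then have range: "1 \<le> u" "v \<le> n"
    using uv b by (auto simp: block_def block_ends_def)
  have "f ` {..n} \<subseteq> {..n}"
  proof -
    have "f 0 = 0" using perm by (simp add: permutes_not_in)
    moreover have "{..n} = insert 0 {1..n}" by auto
    ultimately show ?thesis using img by auto
  qed
  moreover have "(f ^^ l) i \<noteq> i" if "i \<in> {u..v}" for i
    using that range l card k by (intro transitive_perm_aperiodic[OF f]) auto
  ultimately obtain i where i: "i \<in> {u..<v}" "{i, i + 1} \<subseteq> (conv_map f ^^ l) {i, i + 1}"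
    using unit_interval_returns[of f n u v l] uv range ret by auto
  have "char_number f i \<le> l" using i(2) l by (intro char_number_le) auto
  then have "i \<in> J" using i(1) range l card by (auto simp: J_def)
  then show False using cut[OF j(1) uv(3,4) i(1)] by blast
qed

lemma block_returns_if_char_sequence_le:
  assumes C: "\<And>N g. 2 \<le> N \<Longrightarrow> transitive_perm N g \<Longrightarrow>
      \<forall>i\<in>{1..N - 1}. char_sequence N g ! (i - 1) \<le> i"
    and nk: "n \<ge> 1" "k \<ge> 1"
    and f: "\<forall>i\<in>{1..n}. f i \<subseteq> {1..n}" "(\<Union>i\<in>{1..n}. f i) = {1..n}"
    and b: "block_ends n k b"
  shows "\<exists>j\<in>{1..k}. \<exists>r\<in>block b j. \<exists>s\<in>block b j. \<exists>l\<in>{1..k}. {r, s} \<subseteq> (conv_setmap f ^^ l) {r, s}"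
proof -
  obtain c where c: "c \<noteq> []" "distinct c" "set c \<subseteq> {1..n}"
    "\<And>i. i < length c \<Longrightarrow> c ! ((i + 1) mod length c) \<in> f (c ! i)"
    using covering_map_has_cycle[of "{1..n}" f] f(2) nk(1) by auto
  define N where "N = length c"
  obtain e g where g: "transitive_perm N g" and mono: "mono_on {1..N} e"
    and e: "e ` {1..N} = set c" and sel: "\<And>i. i \<in> {1..N} \<Longrightarrow> e (g i) \<in> f (e i)"
    by (rule cycle_relabelling[OF c(1,2,4)]) (assumption, rule that[unfolded N_def], assumption+)
  have N1: "1 \<le> N" using c(1) by (simp add: N_def Suc_le_eq)
  have img: "g ` {1..N} \<subseteq> {1..N}"
    using g permutes_image unfolding transitive_perm_def by blast
  have en: "e ` {1..N} \<subseteq> {1..n}" using e c(3) by simp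
  have transfer: "e ` A \<subseteq> (conv_setmap f ^^ l) (e ` A)"
    if "A \<subseteq> (conv_map g ^^ l) A" "A \<subseteq> {1..N}" for A l
  proof -
    have "e ` (conv_map g ^^ l) A \<subseteq> (conv_setmap f ^^ l) (e ` A)"
      using conv_map_funpow_relabel[where f = f and l = l, OF mono en img bspec[OF f(1)] sel that(2)]
      by (rule conjunct1)
    then show ?thesis using image_mono[OF that(1)] by (rule subset_trans[rotated])
  qed
  show ?thesis
  proof (cases "N \<le> k")
    case True
    \<comment> \<open>A point of the cycle is a degenerate pair that returns after \<open>N\<close> steps.\<close>
    have "(g ^^ N) 1 \<in> (conv_map g ^^ N) {1}"
      by (rule funpow_in_conv_map_funpow) auto
    then have "e ` {1} \<subseteq> (conv_setmap f ^^ N) (e ` {1})"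
      using transitive_perm_funpow_n[OF g, of 1] N1 by (intro transfer) auto
    then have ret: "{e 1, e 1} \<subseteq> (conv_setmap f ^^ N) {e 1, e 1}" by simp
    have "e 1 \<in> {1..n}" using en N1 by (simp add: image_subset_iff)
    note block = block_index[OF b this]
    have "N \<in> {1..k}" using True N1 by simp
    with ret block show ?thesis by blast
  next
    case False
    define S where "S = {i \<in> {1..<N}. char_number g i \<le> k}"
    have kN: "k \<in> {1..N - 1}" using False nk by auto
    then have "char_sequence N g ! (k - 1) \<le> k"
      using C[OF _ g] False nk by auto
    then have "k \<le> card S"
      using char_sequence_le_iff[OF kN] by (simp add: S_def)
    moreover have "S \<subseteq> {1..<N}" unfolding S_def by blast
    ultimately obtain i j where i: "i \<in> S" and j: "j \<in> {1..k}" "e i \<in> block b j" "e (i + 1) \<in> block b j"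
      using consecutive_in_block[OF b mono en, of S] nk(2) by blast
    have iN: "i \<in> {1..<N}" and ik: "char_number g i \<le> k" using i by (auto simp: S_def)
    have "e ` {i, i + 1} \<subseteq> (conv_setmap f ^^ char_number g i) (e ` {i, i + 1})"
      using char_number_returns(2)[OF g iN] iN by (intro transfer) auto
    then have "{e i, e (i + 1)} \<subseteq> (conv_setmap f ^^ char_number g i) {e i, e (i + 1)}"
      by simp
    then show ?thesis
      using j ik char_number_returns(1)[OF g iN] by (meson atLeastAtMost_iff)
  qed
qed

theorem theorem1p8:
  shows "(\<forall>n\<ge>2. \<forall>f. transitive_perm n f \<longrightarrow>
            (\<forall>i\<in>{1..n - 1}. char_sequence n f ! (i - 1) \<le> i))
         \<longleftrightarrow>
         (\<forall>n\<ge>1. \<forall>k\<ge>1. \<forall>(f :: nat \<Rightarrow> nat set) b.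
            (\<forall>i\<in>{1..n}. f i \<subseteq> {1..n}) \<longrightarrow> (\<Union>i\<in>{1..n}. f i) = {1..n} \<longrightarrow>
            block_ends n k b \<longrightarrow>
            (\<exists>j\<in>{1..k}. \<exists>r\<in>block b j. \<exists>s\<in>block b j. \<exists>l\<in>{1..k}.
               {r, s} \<subseteq> (conv_setmap f ^^ l) {r, s}))"
  (is "?C \<longleftrightarrow> ?D")
proof
  assume ?C
  then show ?D
    by (intro allI impI block_returns_if_char_sequence_le) blast+
next
  assume D: ?D
  show ?C
  proof (intro allI impI ballI)
    fix n f i
    assume "2 \<le> n" "transitive_perm n f" "i \<in> {1..n - 1}"
    moreover from \<open>2 \<le> n\<close> have "1 \<le> n" by simp
    ultimately show "char_sequence n f ! (i - 1) \<le> i"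
      using D by (intro char_sequence_le_if_block_returns) blast+
  qed
qed

end
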